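(* The numbers $a_i(n,s,t)$ satisfy the following recurrences. (1) If $n\ge 2$, $s>0$, $i>1$, $2\le t\le n$ and $s+t<n-2i+3$, then $$a_i(n,s,t)=\sum_{\ell=2}^{m}\left(\binom{\ell+t-1}{\ell}-1\right)a_{i-1}(n-t,s,\ell),\qquad m=n-s-t-2i+4.$$ (2) If $s>0$ and $2\le t\le n-s$, then $$a_1(n,s,t)=\left(\binom{s+t-1}{s}-1\right)a(n-t,s).$$ (3) If $i\ge1$ and $1\le t\le n$, then $$a_i(n,0,t)=\delta_{n,t}+\sum_{\ell=1}^{n-t}\left(\binom{\ell+t-1}{\ell}-1\right)a_{i-1}(n-t,0,\ell),$$ where $a_0(n-t,0,\ell)$ is understood to be always zero.
   Context: For a positive integer $n$, $\mathcal{L}_n$ denotes the set of all words $a=(a_1,a_2,\ldots,a_n)$ over the alphabet of non-negative integers satisfying: (i) $a_{i+1}\ge a_i-1$ for $1\le i<n$; and (ii) if $a_i=k>0$ with $i$ minimal (i.e. $i$ is the position of the left-most occurrence of the letter $k$), then there exist $i_1<i<i_2$ such that $a_{i_1}=a_{i_2}=k-1$. For $1\le m\le n$, $a(n,m)$ is the number of words in $\mathcal{L}_n$ containing exactly $m$ zeros. For $i\ge1$, $s\ge0$, $t\ge 1$, $a_i(n,s,t)$ is the number of words in $\mathcal{L}_n$ containing exactly $s$ occurrences of the letter $i$ and exactly $t$ zeros. (When $s>0$ it can be non-zero only for $n\ge2$, $1\le i\le\lfloor\frac{n-1}{2}\rfloor$, $2\le t\le n$, $1\le s\le n-t-2i+2$;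 when $s=0$ the range is $1\le t\le n$, $i\ge1$, and $a_i(n,0,t)$ counts the words with exactly $t$ zeros and no letter equal to $i$.) $\delta_{n,t}$ is the Kronecker delta, and an empty sum is $0$. *)

theory Defs
  imports Complex_Main
begin

text \<open>
  Words are lists indexed from 0, so the letter $a_i$ of the paper is \<open>a ! (i - 1)\<close>.
  Condition (i), $a_{i+1} \ge a_i - 1$, is written without truncated subtraction.
\<close>

definition words :: "nat \<Rightarrow> nat list set" where
  "words n = {a. length a = n
     \<and> (\<forall>i. i + 1 < n \<longrightarrow> a ! i \<le> a ! (i + 1) + 1)
     \<and> (\<forall>i < n. a ! i > 0 \<and> (\<forall>j < i. a ! j \<noteq> a ! i) \<longrightarrow>
          (\<exists>i1 i2. i1 < i \<and> i < i2 \<and> i2 < n \<and> a ! i1 = a ! i - 1 \<and> a ! i2 = a ! i - 1))}"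

definition num_words :: "nat \<Rightarrow> nat \<Rightarrow> nat" where
  "num_words n m = card {a \<in> words n. count_list a 0 = m}"

text \<open>\<open>num_words_letter i n s t\<close> is $a_i(n,s,t)$, meant for \<open>i \<ge> 1\<close> only.\<close>

definition num_words_letter :: "nat \<Rightarrow> nat \<Rightarrow> nat \<Rightarrow> nat \<Rightarrow> nat" where
  "num_words_letter i n s t = card {a \<in> words n. count_list a i = s \<and> count_list a 0 = t}"

end

theory Submission
  imports Defs
begin

text \<open>
  Deleting the zeros of a word and lowering every other letter by one gives a shorter word, the
  \<^emph>\<open>core\<close>; its zeros are the former ones. Condition (i) survives because only a zero or a one can
  stand directly before a zero, so a deleted block of zeros is preceded by nothing or by a one, and
  a one may be followed by any nonzero letter. Condition (ii) for \<open>k \<ge> 2\<close> mentions nonzero letters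
  only, so it is condition (ii) for \<open>k - 1\<close> in the core.

  For the same reason the zeros can be put back only at the beginning and immediately after ones.
  How they are distributed over these places is recorded by the \<^emph>\<open>skeleton\<close>, the subsequence of zeros
  and ones. Hence a word is the same thing as a core together with a skeleton that has as many ones
  as the core has zeros (\<open>bij_betw_skeleton_core\<close>), where the skeleton inherits condition (ii) for the
  letter 1: there is a zero before and a zero after the first one.

  For \<open>t, l \<ge> 1\<close>, a skeleton with \<open>t\<close> zeros and \<open>l\<close> ones therefore is a zero followed by an arbitrary
  sequence of \<open>t - 1\<close> zeros and \<open>l\<close> ones other than the one with all its zeros in front, which leaves
  \<open>binomial (l + t - 1) l - 1\<close> choices (\<open>card_skeletons\<close>). For \<open>l = 0\<close> the core has no zero, so it is
  empty, and the word consists of zeros; this is the Kronecker delta.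

  A letter \<open>i \<ge> 2\<close> of the word is the letter \<open>i - 1\<close> of the core, so classifying words by their number
  \<open>l\<close> of ones yields the recurrences with a sum, whereas for \<open>i = 1\<close> the number of ones is prescribed
  and only one summand is left. The range of \<open>l\<close> in the first recurrence is cut down by
  \<open>zeros_bound\<close>: below an occurring letter, every letter occurs at least twice.
\<close>

section \<open>Words as lists\<close>

text \<open>
  Condition (i) of the definition of a word.
\<close>

definition smooth :: "nat list \<Rightarrow> bool" where
  "smooth a \<longleftrightarrow> successively (\<lambda>x y. x \<le> Suc y) a"

text \<open>
  Condition (ii) for the letter \<open>Suc k\<close>. Cutting the list at the first occurrence of \<open>Suc k\<close>, instead
  of speaking of positions, makes the condition commute with \<open>filter\<close>.
\<close>

definition flanked :: "nat \<Rightarrow> nat list \<Rightarrow> bool" where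
  "flanked k a \<longleftrightarrow> (Suc k \<in> set a \<longrightarrow>
     k \<in> set (takeWhile (\<lambda>x. x \<noteq> Suc k) a) \<and> k \<in> set (dropWhile (\<lambda>x. x \<noteq> Suc k) a))"

lemma smooth_Nil [simp]: "smooth []"
  by (simp add: smooth_def)

lemma smooth_Cons: "smooth (x # a) \<longleftrightarrow> (a = [] \<or> x \<le> Suc (hd a)) \<and> smooth a"
  by (cases a) (auto simp: smooth_def)

lemma smooth_iff_nth: "smooth a \<longleftrightarrow> (\<forall>i. i + 1 < length a \<longrightarrow> a ! i \<le> a ! (i + 1) + 1)"
  by (auto simp: smooth_def successively_conv_nth)

lemma split_at_first:
  assumes "i < length a" and "a ! i = x" and "\<forall>j<i. a ! j \<noteq> x"
  shows "takeWhile (\<lambda>y. y \<noteq> x) a = take i a" and "dropWhile (\<lambda>y. y \<noteq> x) a = drop i a"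
proof -
  show *: "takeWhile (\<lambda>y. y \<noteq> x) a = take i a"
    using assms by (intro takeWhile_eq_take_P_nth) auto
  have "length (takeWhile (\<lambda>y. y \<noteq> x) a) = i"
    using * assms(1) by simp
  then show "dropWhile (\<lambda>y. y \<noteq> x) a = drop i a"
    by (simp add: dropWhile_eq_drop)
qed

text \<open>
  The suffix beginning at position \<open>i\<close> includes position \<open>i\<close> itself, which is harmless because the
  letter there is \<open>Suc k\<close>, not \<open>k\<close>.
\<close>

lemma flanked_iff_nth:
  assumes "i < length a" and "a ! i = Suc k" and "\<forall>j<i. a ! j \<noteq> Suc k"
  shows "flanked k a \<longleftrightarrow>
    (\<exists>i1 i2. i1 < i \<and> i < i2 \<and> i2 < length a \<and> a ! i1 = k \<and> a ! i2 = k)"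
proof -
  have "Suc k \<in> set a" using assms(1,2) nth_mem by metis
  then have "flanked k a \<longleftrightarrow> k \<in> set (take i a) \<and> k \<in> set (drop i a)"
    using split_at_first[OF assms] by (simp add: flanked_def)
  also have "k \<in> set (take i a) \<longleftrightarrow> (\<exists>i1<i. a ! i1 = k)"
    using assms(1) by (auto simp: in_set_conv_nth)
  also have "k \<in> set (drop i a) \<longleftrightarrow> (\<exists>i2. i < i2 \<and> i2 < length a \<and> a ! i2 = k)"
  proof -
    have "drop i a = Suc k # drop (Suc i) a"
      using assms(1,2) Cons_nth_drop_Suc by metis
    then have "k \<in> set (drop i a) \<longleftrightarrow> k \<in> set (drop (Suc i) a)" by simp
    also have "\<dots> \<longleftrightarrow> (\<exists>i2. i < i2 \<and> i2 < length a \<and> a ! i2 = k)"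
    proof
      assume "k \<in> set (drop (Suc i) a)"
      then obtain j where "j < length a - Suc i" "a ! (Suc i + j) = k"
        using assms(1) by (auto simp: in_set_conv_nth)
      then show "\<exists>i2. i < i2 \<and> i2 < length a \<and> a ! i2 = k"
        by (intro exI[of _ "Suc i + j"]) auto
    next
      assume "\<exists>i2. i < i2 \<and> i2 < length a \<and> a ! i2 = k"
      then obtain i2 where "i < i2" "i2 < length a" "a ! i2 = k" by blast
      then show "k \<in> set (drop (Suc i) a)"
        unfolding in_set_conv_nth by (intro exI[of _ "i2 - Suc i"]) auto
    qed
    finally show ?thesis .
  qed
  finally show ?thesis by blast
qed

lemma words_iff:
  "a \<in> words n \<longleftrightarrow> length a = n \<and> smooth a \<and> (\<forall>k. flanked k a)"
proof -
  have "(\<forall>i < length a. a ! i > 0 \<and> (\<forall>j < i. a ! j \<noteq> a ! i) \<longrightarrow>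
      (\<exists>i1 i2. i1 < i \<and> i < i2 \<and> i2 < length a \<and> a ! i1 = a ! i - 1 \<and> a ! i2 = a ! i - 1))
    \<longleftrightarrow> (\<forall>k. flanked k a)" (is "?L \<longleftrightarrow> ?R")
  proof
    assume L: ?L
    show ?R
    proof
      fix k
      show "flanked k a"
      proof (cases "Suc k \<in> set a")
        case True
        define i where "i = (LEAST i. i < length a \<and> a ! i = Suc k)"
        have i: "i < length a" "a ! i = Suc k"
          using LeastI_ex[of "\<lambda>i. i < length a \<and> a ! i = Suc k"] True
          unfolding i_def in_set_conv_nth by auto
        have first: "\<forall>j<i. a ! j \<noteq> Suc k"
          using not_less_Least[of _ "\<lambda>i. i < length a \<and> a ! i = Suc k"] i(1)
          unfolding i_def[symmetric] by auto
        show ?thesis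
          using L[rule_format, of i] i first unfolding flanked_iff_nth[OF i first] by simp
      qed (simp add: flanked_def)
    qed
  next
    assume R: ?R
    show ?L
    proof (intro allI impI)
      fix i assume i: "i < length a" and *: "a ! i > 0 \<and> (\<forall>j < i. a ! j \<noteq> a ! i)"
      then have "a ! i = Suc (a ! i - 1)" by simp
      with i * R show "\<exists>i1 i2. i1 < i \<and> i < i2 \<and> i2 < length a
          \<and> a ! i1 = a ! i - 1 \<and> a ! i2 = a ! i - 1"
        using flanked_iff_nth[of i a "a ! i - 1"] by auto
    qed
  qed
  then show ?thesis
    unfolding words_def smooth_iff_nth by auto
qed

section \<open>Multiplicities of letters and finiteness\<close>

lemma count_ge_2_if_Suc_in_set:
  assumes "flanked k a" and "Suc k \<in> set a"
  shows "2 \<le> count_list a k"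
proof -
  let ?P = "\<lambda>x. x \<noteq> Suc k"
  have "count_list a k = count_list (takeWhile ?P a) k + count_list (dropWhile ?P a) k"
    by (metis count_list_append takeWhile_dropWhile_id)
  moreover have "count_list (takeWhile ?P a) k \<noteq> 0" "count_list (dropWhile ?P a) k \<noteq> 0"
    using assms by (auto simp: flanked_def count_list_0_iff)
  ultimately show ?thesis by linarith
qed

lemma smaller_letter_in_set:
  assumes "\<forall>k. flanked k a" and "k \<in> set a" and "j \<le> k"
  shows "j \<in> set a"
  using assms(3,2)
proof (induction rule: inc_induct)
  case (step m)
  then have "2 \<le> count_list a m"
    using assms(1) by (blast intro: count_ge_2_if_Suc_in_set)
  then show ?case by (metis count_list_0_iff not_numeral_le_zero)
qed

lemma smaller_letter_count_ge_2:
  assumes "\<forall>k. flanked k a" and "k \<in> set a" and "j < k"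
  shows "2 \<le> count_list a j"
  using assms smaller_letter_in_set[of a k "Suc j"] by (simp add: count_ge_2_if_Suc_in_set)

text \<open>
  The letters of a word have no gaps, so that a letter \<open>k\<close> forces \<open>k + 1\<close> distinct letters and thus
  \<open>k < n\<close>.
\<close>

lemma finite_words: "finite (words n)"
proof (rule finite_subset)
  show "words n \<subseteq> {a. set a \<subseteq> {..<n} \<and> length a = n}"
  proof safe
    fix a k assume a: "a \<in> words n" and k: "k \<in> set a"
    then have "{..k} \<subseteq> set a"
      using smaller_letter_in_set by (auto simp: words_iff)
    then have "card {..k} \<le> card (set a)" by (intro card_mono) auto
    also have "\<dots> \<le> n" using a card_length[of a] by (simp add: words_iff)
    finally show "k < n" by simp
  qed (simp add: words_iff)
qed (simp add: finite_lists_length_eq)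

text \<open>
  The \<open>j - 1\<close> letters strictly between \<open>0\<close> and \<open>j\<close> take up at least two places each.
\<close>

lemma zeros_bound:
  assumes a: "a \<in> words n" and j: "j \<ge> 1" "j \<in> set a"
  shows "count_list a 0 + count_list a j + 2 * (j - 1) \<le> n"
proof -
  have flank: "\<forall>k. flanked k a" using a by (simp add: words_iff)
  have "2 * (j - 1) = (\<Sum>k\<in>{1..<j}. 2)" by simp
  also have "\<dots> \<le> (\<Sum>k\<in>{1..<j}. count_list a k)"
    using smaller_letter_count_ge_2[OF flank j(2)] by (intro sum_mono) auto
  finally have "count_list a 0 + count_list a j + 2 * (j - 1)
      \<le> (\<Sum>k\<in>{0, j} \<union> {1..<j}. count_list a k)"
    using j(1) by (subst sum.union_disjoint) auto
  also have "\<dots> \<le> (\<Sum>k\<in>({0, j} \<union> {1..<j}) \<union> set a. count_list a k)"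
    by (intro sum_mono2) auto
  also have "\<dots> = n"
    using a by (subst sum_count_set) (auto simp: words_iff)
  finally show ?thesis .
qed

section \<open>Splitting a word into skeleton and core\<close>

definition skeleton :: "nat list \<Rightarrow> nat list" where
  "skeleton a = filter (\<lambda>x. x \<le> 1) a"

definition core :: "nat list \<Rightarrow> nat list" where
  "core a = map (\<lambda>x. x - 1) (filter (\<lambda>x. x \<noteq> 0) a)"

text \<open>
  The inverse of the splitting: \<open>w\<close> is the skeleton and \<open>c\<close> is the core raised by one. A zero of the
  skeleton is written out as soon as it is reached, since it belongs directly behind the preceding
  one; a one of the skeleton asks to copy \<open>c\<close> up to and including its next one. The third equation is
  reached only if the skeleton has more ones than \<open>c\<close>, and its value is arbitrary.
\<close>

fun merge :: "nat list \<Rightarrow> nat list \<Rightarrow> nat list" where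
  "merge [] c = c"
| "merge (0 # w) c = 0 # merge w c"
| "merge (Suc k # w) [] = []"
| "merge (Suc k # w) (x # c) = x # (if x = 1 then merge w c else merge (Suc k # w) c)"

lemma map_Suc_core: "map Suc (core a) = filter (\<lambda>x. x \<noteq> 0) a"
  by (induction a) (auto simp: core_def)

text \<open>
  From a letter \<open>\<ge> 2\<close>, a word descends in steps of one, so it passes through 1 before it reaches 0.
  This is what makes the position of the zeros recoverable from the skeleton.
\<close>

lemma hd_skeleton_after_big:
  assumes "smooth (x # a)" and "2 \<le> x" and "skeleton a = y # w"
  shows "y = 1"
  using assms
proof (induction a arbitrary: x)
  case (Cons z a)
  show ?case
  proof (cases "z \<le> 1")
    case True
    then show ?thesis using Cons.prems by (auto simp: smooth_Cons skeleton_def)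
  next
    case False
    then show ?thesis
      using Cons.prems by (intro Cons.IH[of z]) (auto simp: smooth_Cons skeleton_def)
  qed
qed (simp add: skeleton_def)

lemma merge_skeleton_core:
  "smooth a \<Longrightarrow> merge (skeleton a) (map Suc (core a)) = a"
proof (induction a)
  case Nil
  then show ?case by (simp add: skeleton_def core_def)
next
  case (Cons x a)
  have IH: "merge (skeleton a) (map Suc (core a)) = a"
    using Cons by (simp add: smooth_Cons)
  consider "x = 0" | "x = 1" | "2 \<le> x" by linarith
  then show ?case
  proof cases
    case 3
    have eq: "skeleton (x # a) = skeleton a" "map Suc (core (x # a)) = x # map Suc (core a)"
      using 3 by (simp_all add: skeleton_def core_def)
    show ?thesis
    proof (cases "skeleton a")
      case Nil
      then show ?thesis using IH eq by simp
    next
      case (Cons y w)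
      then have "y = Suc 0"
        using hd_skeleton_after_big[OF Cons.prems 3] by simp
      then show ?thesis using IH eq Cons 3 by simp
    qed
  qed (use IH in \<open>simp_all add: skeleton_def core_def\<close>)
qed

text \<open>
  A descent by two or more could only arise between a letter \<open>\<ge> 2\<close> and an inserted zero; but after such
  a letter \<open>merge\<close> goes on copying \<open>c\<close>.
\<close>

lemma smooth_merge:
  "smooth c \<Longrightarrow> 0 \<notin> set c \<Longrightarrow> smooth (merge w c)"
proof (induction w c rule: merge.induct)
  case (4 k w x c)
  show ?case
  proof (cases "x = 1")
    case False
    have "smooth (merge (Suc k # w) c)"
      using 4 False by (simp add: smooth_Cons)
    moreover have "merge (Suc k # w) c = [] \<or> x \<le> Suc (hd (merge (Suc k # w) c))"
      using 4(3) by (cases c) (auto simp: smooth_Cons)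
    ultimately show ?thesis using False by (simp add: smooth_Cons)
  qed (use 4 in \<open>simp add: smooth_Cons\<close>)
qed (simp_all add: smooth_Cons)

lemma filters_merge:
  assumes "set w \<subseteq> {0, 1}" and "count_list w 1 = count_list c 1" and "0 \<notin> set c"
  shows "skeleton (merge w c) = w" and "filter (\<lambda>x. x \<noteq> 0) (merge w c) = c"
proof -
  have "skeleton (merge w c) = w \<and> filter (\<lambda>x. x \<noteq> 0) (merge w c) = c"
    using assms
  proof (induction w c rule: merge.induct)
    case (1 c)
    then have "\<not> x \<le> 1" if "x \<in> set c" for x
      using that count_list_0_iff[of c 1] by (metis One_nat_def count_list.simps(1) le_Suc_eq le_zero_eq)
    moreover have "x \<noteq> 0" if "x \<in> set c" for x
      using 1 that by metis
    ultimately show ?case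
      by (simp add: skeleton_def filter_empty_conv)
  next
    case (4 k w x c)
    show ?case
    proof (cases "x = 1")
      case True
      then show ?thesis using 4 by (auto simp: skeleton_def)
    next
      case False
      then have "2 \<le> x" using 4(5) by (cases x) auto
      then show ?thesis using 4 False by (auto simp: skeleton_def)
    qed
  qed (auto simp: skeleton_def)
  then show "skeleton (merge w c) = w" and "filter (\<lambda>x. x \<noteq> 0) (merge w c) = c"
    by blast+
qed

text \<open>
  Deleting a zero after \<open>x\<close> is only critical for the pair formed by \<open>x\<close> and the next nonzero letter,
  and there \<open>x \<le> 1\<close>.
\<close>

lemma smooth_core: "smooth a \<Longrightarrow> smooth (core a)"
proof (induction a)
  case (Cons x a)
  have IH: "smooth (core a)" using Cons by (simp add: smooth_Cons)
  show ?case
  proof (cases "x = 0 \<or> core a = []")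
    case True
    then show ?thesis using IH by (auto simp: core_def smooth_Cons)
  next
    case False
    then have "a \<noteq> []" by (auto simp: core_def)
    then obtain y b where a: "a = y # b" by (cases a) auto
    have "x \<le> Suc y" using Cons.prems a by (simp add: smooth_Cons)
    then have "x - 1 \<le> Suc (hd (core a))"
      by (cases "y = 0") (auto simp: a core_def)
    then show ?thesis using IH False by (simp add: core_def smooth_Cons)
  qed
qed (simp add: core_def)

lemma smooth_map_Suc [simp]: "smooth (map Suc b) \<longleftrightarrow> smooth b"
  by (simp add: smooth_def successively_map)

text \<open>
  If both letters in question are kept, filtering commutes with cutting at the first \<open>Suc k\<close>. The
  skeleton keeps 0 and 1, the core keeps all pairs of consecutive positive letters, so that together
  they carry every instance of condition (ii).
\<close>

lemma flanked_filter:
  assumes "P k" and "P (Suc k)"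
  shows "flanked k (filter P a) \<longleftrightarrow> flanked k a"
proof -
  have "takeWhile (\<lambda>x. x \<noteq> Suc k) (filter P a) = filter P (takeWhile (\<lambda>x. x \<noteq> Suc k) a)"
    using assms(2) by (induction a) auto
  moreover have "dropWhile (\<lambda>x. x \<noteq> Suc k) (filter P a) = filter P (dropWhile (\<lambda>x. x \<noteq> Suc k) a)"
    using assms(2) by (induction a) auto
  ultimately show ?thesis using assms by (simp add: flanked_def)
qed

lemma flanked_map_Suc: "flanked (Suc k) (map Suc b) \<longleftrightarrow> flanked k b"
  by (auto simp: flanked_def takeWhile_map dropWhile_map comp_def)

lemma flanked_skeleton: "flanked 0 (skeleton a) \<longleftrightarrow> flanked 0 a"
  by (simp add: skeleton_def flanked_filter)

lemma flanked_core: "flanked k (core a) \<longleftrightarrow> flanked (Suc k) a"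
  using flanked_map_Suc[of k "core a"] by (simp add: map_Suc_core flanked_filter)

lemma all_flanked_iff:
  "(\<forall>k. flanked k a) \<longleftrightarrow> flanked 0 (skeleton a) \<and> (\<forall>k. flanked k (core a))"
  by (metis flanked_skeleton flanked_core not0_implies_Suc)

lemma length_core: "length a = count_list a 0 + length (core a)"
  by (induction a) (auto simp: core_def)

lemma count_core: "count_list (core a) k = count_list a (Suc k)"
  by (induction a) (auto simp: core_def)

lemma count_skeleton: "k \<le> 1 \<Longrightarrow> count_list (skeleton a) k = count_list a k"
  by (induction a) (auto simp: skeleton_def)

lemma count_map_Suc: "count_list (map Suc b) (Suc k) = count_list b k"
  by (induction b) auto

definition skeletons :: "nat \<Rightarrow> nat \<Rightarrow> nat list set" where
  "skeletons t l =
     {w. set w \<subseteq> {0, 1} \<and> count_list w 0 = t \<and> count_list w 1 = l \<and> flanked 0 w}"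

text \<open>
  The predicate \<open>Q\<close> lets the same bijection serve for prescribing the number of occurrences of a
  letter in the core and for leaving the core unrestricted.
\<close>

lemma bij_betw_skeleton_core:
  assumes "t \<le> n"
  shows "bij_betw (\<lambda>a. (skeleton a, core a))
    {a \<in> words n. count_list a 0 = t \<and> count_list a 1 = l \<and> Q (core a)}
    (skeletons t l \<times> {b \<in> words (n - t). count_list b 0 = l \<and> Q b})"
proof (rule bij_betw_byWitness[where f' = "\<lambda>(w, b). merge w (map Suc b)"], goal_cases)
  case 1
  show ?case by (auto simp: words_iff merge_skeleton_core)
next
  case inverse: 2
  have "skeleton (merge w (map Suc b)) = w \<and> core (merge w (map Suc b)) = b"
    if "w \<in> skeletons t l" "count_list b 0 = l" for w b
  proof -
    have "count_list (map Suc b) (Suc 0) = count_list b 0"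
      by (rule count_map_Suc)
    with that filters_merge[of w "map Suc b"] show ?thesis
      by (auto simp: skeletons_def core_def comp_def)
  qed
  then show ?case by auto
next
  case 3
  have "set (skeleton a) \<subseteq> {0, 1}" for a
    by (auto simp: skeleton_def)
  moreover have "length (core a) = n - t" if "length a = n" "count_list a 0 = t" for a
    using that length_core[of a] by simp
  ultimately show ?case
    by (auto simp: words_iff skeletons_def flanked_skeleton flanked_core smooth_core count_core
      count_skeleton)
next
  case 4
  have "merge w (map Suc b) \<in> {a \<in> words n. count_list a 0 = t \<and> count_list a 1 = l \<and> Q (core a)}"
    if w: "w \<in> skeletons t l" and b: "b \<in> words (n - t)" "count_list b 0 = l" "Q b" for w b
  proof -
    let ?a = "merge w (map Suc b)"
    have "count_list (map Suc b) (Suc 0) = count_list b 0"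
      by (rule count_map_Suc)
    then have sk: "skeleton ?a = w" and co: "core ?a = b"
      using w b filters_merge[of w "map Suc b"] by (auto simp: skeletons_def core_def comp_def)
    have count: "count_list ?a 0 = t" "count_list ?a 1 = l"
      using w sk count_skeleton[of 0 ?a] count_skeleton[of 1 ?a] by (auto simp: skeletons_def)
    have "length ?a = n"
      using length_core[of ?a] co count b assms by (simp add: words_iff)
    moreover have "smooth ?a"
      using b by (intro smooth_merge) (auto simp: words_iff)
    moreover have "\<forall>k. flanked k ?a"
      using w b all_flanked_iff[of ?a] sk co by (auto simp: skeletons_def words_iff)
    ultimately show ?thesis
      using count co b by (simp add: words_iff)
  qed
  then show ?case by auto
qed

section \<open>Counting skeletons\<close>

definition binary_lists :: "nat \<Rightarrow> nat \<Rightarrow> nat list set" where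
  "binary_lists t l = {w. set w \<subseteq> {0, 1} \<and> count_list w 0 = t \<and> count_list w 1 = l}"

lemma sorted_if_no_late_zero:
  assumes "set w \<subseteq> {0, 1}" and "0 \<notin> set (dropWhile (\<lambda>x. x \<noteq> 1) w)"
  shows "w = replicate (count_list w 0) 0 @ replicate (count_list w (1::nat)) (1::nat)"
  using assms
proof (induction w)
  case (Cons x w)
  show ?case
  proof (cases "x = 0")
    case False
    then have "x = 1" "\<forall>y\<in>set w. y = 1" using Cons.prems by auto
    then obtain n where "w = replicate n 1"
      by (metis replicate_length_same)
    then show ?thesis using \<open>x = 1\<close>
      by (induction n arbitrary: w) auto
  qed (use Cons in auto)
qed simp

lemma binary_lists_no_ones: "binary_lists t 0 = {replicate t 0}"
proof -
  have "w = replicate (count_list w 0) 0" if "set w \<subseteq> {0, 1}" "count_list w 1 = 0" for w :: "nat list"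
  proof -
    have "1 \<notin> set w" using that(2) by (simp add: count_list_0_iff)
    then have "\<forall>x\<in>set w. x \<noteq> 1" by metis
    then show ?thesis
      using sorted_if_no_late_zero[OF that(1)] that(2) by (simp add: dropWhile_eq_Nil_conv[THEN iffD2])
  qed
  moreover have "count_list (replicate t (0::nat)) 0 = t" "count_list (replicate t (0::nat)) 1 = 0"
    by (induction t) auto
  ultimately show ?thesis by (auto simp: binary_lists_def)
qed

lemma binary_lists_no_zeros: "binary_lists 0 l = {replicate l 1}"
proof -
  have "w = replicate (count_list w 1) 1" if "set w \<subseteq> {0, 1}" "count_list w 0 = 0" for w :: "nat list"
  proof -
    have "0 \<notin> set w" using that(2) by (simp add: count_list_0_iff)
    then have "0 \<notin> set (dropWhile (\<lambda>x. x \<noteq> 1) w)" by (metis set_dropWhileD)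
    then show ?thesis
      using sorted_if_no_late_zero[OF that(1)] that(2) by simp
  qed
  moreover have "count_list (replicate l (1::nat)) 0 = 0" "count_list (replicate l (1::nat)) 1 = l"
    by (induction l) auto
  ultimately show ?thesis by (auto simp: binary_lists_def)
qed

text \<open>
  Splitting by the first letter turns the count into Pascal's rule.
\<close>

lemma binary_lists_Suc_Suc:
  "binary_lists (Suc t) (Suc l) =
     Cons 0 ` binary_lists t (Suc l) \<union> Cons 1 ` binary_lists (Suc t) l" (is "?A = ?B")
proof
  show "?A \<subseteq> ?B"
  proof
    fix w assume w: "w \<in> ?A"
    then obtain x v where "w = x # v" by (cases w) (auto simp: binary_lists_def)
    with w show "w \<in> ?B" by (auto simp: binary_lists_def image_iff)
  qed
qed (auto simp: binary_lists_def)

lemma card_binary_lists: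
  "finite (binary_lists t l) \<and> card (binary_lists t l) = (l + t) choose l"
proof (induction t arbitrary: l)
  case 0
  then show ?case by (simp add: binary_lists_no_zeros)
next
  case (Suc t)
  show ?case
  proof (induction l)
    case 0
    then show ?case by (simp add: binary_lists_no_ones)
  next
    case (Suc l)
    have "Cons (0::nat) ` binary_lists t (Suc l) \<inter> Cons 1 ` binary_lists (Suc t) l = {}"
      by auto
    then show ?case
      using Suc \<open>\<And>l. finite (binary_lists t l) \<and> card (binary_lists t l) = (l + t) choose l\<close>
      by (simp add: binary_lists_Suc_Suc card_Un_disjoint card_image)
  qed
qed

lemma skeletons_no_ones: "skeletons t 0 = {replicate t 0}"
proof -
  have "skeletons t 0 = binary_lists t 0"
    by (auto simp: skeletons_def binary_lists_def flanked_def count_list_0_iff)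
  then show ?thesis by (simp add: binary_lists_no_ones)
qed

text \<open>
  The skeleton has a one, so being flanked forces a zero in front, and the only way to miss a zero
  after the first one is to have all zeros first.
\<close>

lemma skeletons_eq:
  assumes "1 \<le> t" and "1 \<le> l"
  shows "skeletons t l =
    Cons 0 ` (binary_lists (t - 1) l - {replicate (t - 1) 0 @ replicate l 1})"
proof -
  let ?late = "\<lambda>w. 0 \<in> set (dropWhile (\<lambda>x::nat. x \<noteq> 1) w)"
  have mem: "0 # v \<in> skeletons t l \<longleftrightarrow> v \<in> binary_lists (t - 1) l \<and> ?late v" for v
    using assms count_list_0_iff[of v 1]
    by (auto simp: skeletons_def binary_lists_def flanked_def)
  have late: "?late v \<longleftrightarrow> v \<noteq> replicate (t - 1) 0 @ replicate l 1"
    if "v \<in> binary_lists (t - 1) l" for v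
  proof -
    have "\<not> ?late (replicate (t - 1) 0 @ replicate l 1)"
      by (auto simp: dropWhile_append dest!: set_dropWhileD split: if_splits)
    then show ?thesis
      using that sorted_if_no_late_zero[of v] by (auto simp: binary_lists_def)
  qed
  have hd0: "\<exists>v. w = 0 # v" if "w \<in> skeletons t l" for w
  proof -
    have "1 \<in> set w" using that assms count_list_0_iff[of w 1] by (auto simp: skeletons_def)
    then have "0 \<in> set (takeWhile (\<lambda>x. x \<noteq> Suc 0) w)"
      using that by (auto simp: skeletons_def flanked_def)
    then show ?thesis
      using that by (cases w) (auto simp: skeletons_def split: if_splits)
  qed
  show ?thesis
    using mem late hd0 by (auto simp: image_iff) blast+
qed

lemma card_skeletons:
  assumes "1 \<le> t" and "1 \<le> l"
  shows "int (card (skeletons t l)) = int ((l + t - 1) choose l) - 1"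
proof -
  let ?B = "binary_lists (t - 1) l" and ?e = "replicate (t - 1) (0::nat) @ replicate l 1"
  have "?e \<in> ?B"
  proof -
    have "count_list (replicate m x) y = (if x = y then m else 0)" for m and x y :: nat
      by (induction m) auto
    then show ?thesis by (auto simp: binary_lists_def)
  qed
  then have "card ?B = Suc (card (?B - {?e}))"
    using card_binary_lists by (metis card.remove)
  moreover have "card ?B = (l + t - 1) choose l"
    using card_binary_lists assms by (simp add: add.commute)
  moreover have "card (skeletons t l) = card (?B - {?e})"
    unfolding skeletons_eq[OF assms] by (simp add: card_image)
  ultimately show ?thesis by simp
qed

section \<open>The recurrences\<close>

lemma card_words_core:
  assumes "1 \<le> t" and "t \<le> n" and "1 \<le> l"
  shows "int (card {a \<in> words n. count_list a 0 = t \<and> count_list a 1 = l \<and> Q (core a)}) =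
    (int ((l + t - 1) choose l) - 1) * int (card {b \<in> words (n - t). count_list b 0 = l \<and> Q b})"
  using bij_betw_same_card[OF bij_betw_skeleton_core[OF assms(2), of l Q]] card_skeletons[OF assms(1,3)]
  by (simp add: card_cartesian_product)

lemma no_zeros_iff:
  assumes "b \<in> words m"
  shows "count_list b 0 = 0 \<longleftrightarrow> b = []"
proof
  assume "count_list b 0 = 0"
  then have "0 \<notin> set b" by (simp add: count_list_0_iff)
  moreover have "0 \<in> set b" if "k \<in> set b" for k
    using assms that smaller_letter_in_set[of b k 0] by (simp add: words_iff)
  ultimately show "b = []" by (cases b) auto
qed simp

text \<open>
  A word without ones has a core without zeros, which is empty. This gives the Kronecker delta.
\<close>

lemma card_words_no_ones:
  assumes "t \<le> n"
  shows "card {a \<in> words n. count_list a 0 = t \<and> count_list a 1 = 0 \<and> Q (core a)} =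
    (if n = t \<and> Q [] then 1 else 0)"
proof -
  have "{b \<in> words (n - t). count_list b 0 = 0 \<and> Q b} = (if n = t \<and> Q [] then {[]} else {})"
    using assms by (auto simp: no_zeros_iff words_iff flanked_def cong: conj_cong)
  then show ?thesis
    using bij_betw_same_card[OF bij_betw_skeleton_core[OF assms, of 0 Q]]
    by (simp add: card_cartesian_product skeletons_no_ones)
qed

lemma num_words_letter_split:
  assumes t: "1 \<le> t" "t \<le> n"
  shows "int (num_words_letter (Suc (Suc j)) n s t) = (if n = t \<and> s = 0 then 1 else 0) +
    (\<Sum>l = 1..n - t. (int ((l + t - 1) choose l) - 1) * int (num_words_letter (Suc j) (n - t) s l))"
proof -
  let ?Q = "\<lambda>b. count_list b (Suc j) = s"
  let ?S = "\<lambda>l. {a \<in> words n. count_list a 0 = t \<and> count_list a 1 = l \<and> ?Q (core a)}"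
  have "count_list a 1 \<le> n - t" if "a \<in> words n" "count_list a 0 = t" for a
    using that length_core[of a] count_le_length[of "core a" 0]
    by (auto simp: words_iff count_core)
  then have "{a \<in> words n. count_list a (Suc (Suc j)) = s \<and> count_list a 0 = t} = (\<Union>l\<in>{0..n - t}. ?S l)"
    by (auto simp: count_core)
  then have "num_words_letter (Suc (Suc j)) n s t = (\<Sum>l = 0..n - t. card (?S l))"
    unfolding num_words_letter_def
    by (simp only:) (intro card_UN_disjoint, auto simp: finite_words)
  also have "\<dots> = card (?S 0) + (\<Sum>l = 1..n - t. card (?S l))"
    by (simp add: sum.atLeast_Suc_atMost)
  finally have "int (num_words_letter (Suc (Suc j)) n s t) =
      int (card (?S 0)) + (\<Sum>l = 1..n - t. int (card (?S l)))"
    by simp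
  also have "card (?S 0) = (if n = t \<and> s = 0 then 1 else 0)"
    using card_words_no_ones[OF t(2), of ?Q] by auto
  also have "(\<Sum>l = 1..n - t. int (card (?S l))) = (\<Sum>l = 1..n - t.
      (int ((l + t - 1) choose l) - 1) * int (num_words_letter (Suc j) (n - t) s l))"
    unfolding num_words_letter_def
    by (intro sum.cong refl, subst card_words_core) (use t in \<open>auto simp: conj_commute\<close>)
  finally show ?thesis by simp
qed

lemma num_words_letter_1:
  assumes "1 \<le> t" "t \<le> n" "1 \<le> s"
  shows "int (num_words_letter 1 n s t) =
    (int ((s + t - 1) choose s) - 1) * int (num_words (n - t) s)"
  using card_words_core[OF assms, of "\<lambda>_. True"]
  by (simp add: num_words_letter_def num_words_def conj_commute)

lemma num_words_letter_1_0:
  assumes "t \<le> n"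
  shows "num_words_letter 1 n 0 t = (if n = t then 1 else 0)"
  using card_words_no_ones[OF assms, of "\<lambda>_. True"]
  by (simp add: num_words_letter_def conj_commute)

text \<open>
  The summands outside the range of the first recurrence vanish.
\<close>

lemma num_words_letter_eq_0:
  assumes "1 \<le> j" "0 < s" and "l < 2 \<or> n + 2 < l + s + 2 * j"
  shows "num_words_letter j n s l = 0"
proof -
  have False if a: "a \<in> words n" "count_list a j = s" "count_list a 0 = l" for a
  proof -
    have j: "j \<in> set a" using a(2) assms(2) by (metis count_list_0_iff less_irrefl)
    show False
      using zeros_bound[OF a(1) assms(1) j] smaller_letter_count_ge_2[of a j 0] j a assms
      by (auto simp: words_iff)
  qed
  then have none: "{a \<in> words n. count_list a j = s \<and> count_list a 0 = l} = {}" by blast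
  show ?thesis unfolding num_words_letter_def none by simp
qed

theorem proposition3p1:
  shows
   "(\<forall>n s i t :: nat. n \<ge> 2 \<and> s > 0 \<and> i > 1 \<and> 2 \<le> t \<and> t \<le> n \<and>
        int s + int t < int n - 2 * int i + 3 \<longrightarrow>
        int (num_words_letter i n s t) =
          (\<Sum>l = 2..nat (int n - int s - int t - 2 * int i + 4).
             (int ((l + t - 1) choose l) - 1) * int (num_words_letter (i - 1) (n - t) s l)))
    \<and> (\<forall>n s t :: nat. s > 0 \<and> 2 \<le> t \<and> int t \<le> int n - int s \<longrightarrow>
        int (num_words_letter 1 n s t) =
          (int ((s + t - 1) choose s) - 1) * int (num_words (n - t) s))
    \<and> (\<forall>n i t :: nat. i \<ge> 1 \<and> 1 \<le> t \<and> t \<le> n \<longrightarrow>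
        int (num_words_letter i n 0 t) =
          (if n = t then 1 else 0) +
          (\<Sum>l = 1..n - t.
             (int ((l + t - 1) choose l) - 1) *
             (if i = 1 then 0 else int (num_words_letter (i - 1) (n - t) 0 l))))"
proof (intro conjI allI impI, goal_cases)
  case (1 n s i t)
  then obtain j where i: "i = Suc (Suc j)" by (metis One_nat_def Suc_less_eq2 less_imp_Suc_add)
  let ?m = "nat (int n - int s - int t - 2 * int i + 4)"
  let ?f = "\<lambda>l. (int ((l + t - 1) choose l) - 1) * int (num_words_letter (i - 1) (n - t) s l)"
  have "int (num_words_letter i n s t) = (\<Sum>l = 1..n - t. ?f l)"
    using num_words_letter_split[of t n j s] 1 i by simp
  \<comment> \<open>\<open>l = 1\<close> drops out because \<open>i - 1\<close> occurs in the core, and \<open>l > m\<close> by \<open>zeros_bound\<close>.\<close>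
  also have "\<dots> = (\<Sum>l = 2..?m. ?f l)"
  proof (intro sum.mono_neutral_right ballI)
    fix l assume "l \<in> {1..n - t} - {2..?m}"
    then have "l < 2 \<or> (n - t) + 2 < l + s + 2 * (i - 1)"
      using 1 by auto
    then show "?f l = 0"
      using num_words_letter_eq_0[of "i - 1" s l "n - t"] 1 by (simp add: le_diff_conv2)
  qed (use 1 in auto)
  finally show ?case .
next
  case (2 n s t)
  then show ?case using num_words_letter_1[of t n s] by simp
next
  case (3 n i t)
  show ?case
  proof (cases "i = 1")
    case True
    then show ?thesis using num_words_letter_1_0[of t n] 3 by simp
  next
    case False
    then obtain j where "i = Suc (Suc j)" using 3 by (metis One_nat_def not0_implies_Suc not_one_le_zero)
    then show ?thesis using num_words_letter_split[of t n j 0] 3 by simp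
  qed
qed

end
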